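(* Let $u\equiv 1$ on $(0,1)$. The following statements hold. 1. Let $h\in(0,1)$ and consider the mesh subdividing $(0,1)$ into the two intervals $(0,1-h)$ and $(1-h,1)$. For $1\le q<\infty$, the solution of the constrained best approximation problem $$u_h=\mathrm{arg\,min}\,\{\|u-v_h\|_{L^q((0,1))} : v_h\in U_h,\ v_h(0)=1,\ v_h(1)=0\}$$ is the continuous piecewise linear function $u_h$ on this mesh with $u_h(0)=1$, $u_h(1)=0$ and $u_h(1-h)=\alpha$, where $\alpha$ is as follows. (a) If $q=1$, then $\alpha=1$ if $h\le 0.5$, and $\alpha=\sqrt{2h}$ if $h>0.5$. (b) If $1<q<\infty$, then $\alpha>1$ and $$0=-(1-h)\alpha^2 q(\alpha-1)^{q-1}-h(\alpha q+1)(\alpha-1)^q+h.$$ 2. Let $N\ge 2$ and let the mesh be given by the subdivision of $(0,1)$ into the $N$ intervals $(x_{i-1},x_i)$, $i=1,\dots,N$, with $0=x_0<x_1<\dots<x_{N-1}<x_N=1$, and let $h_i=x_i-x_{i-1}$, $i=1,\dots,N$. Define $\vartheta_N:=0$ and, successively for $i=N-1,\dots,1$, let $\vartheta_i\ge 0$ be given by $$\vartheta_i^2:=\frac12\left(1-\left(2(1-\vartheta_{i+1})^2-1\right)\frac{h_{i+1}}{h_i}\right),$$ where the recursion stops (and $\vartheta_i,\vartheta_{i-1},\dots,\vartheta_1$ are left undefined) as soon as the right-hand side is negative. Define $$M:=\max\left(\{0\}\cup\left\{i\in\{1,\dots,N-1\} : \vartheta_i \text{ is defined and } \vartheta_i\ge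 1-\frac{1}{\sqrt2}\right\}\right).$$ If for every integer $i$ with $\max\{M,1\}\le i\le N-1$ the number $\vartheta_{i+1}$ is defined and $$h_i\ge\left(2(1-\vartheta_{i+1})^2-1\right)h_{i+1},$$ then there exists an $L^1$-best approximation $u_h$ of $u\equiv 1$ with $u_h(0)=1$ and $u_h(1)=0$ satisfying $u_h(x_i)=1$ for all $i=1,\dots,N-1$ (hence $u_h$ contains no over- or undershoots). 3. Let $N\ge2$ and let the mesh be given by the subdivision of $(0,1)$ into the $N$ intervals $(x_{i-1},x_i)$, $i=1,\dots,N$, with $0=x_0<x_1<\dots<x_{N-1}<x_N=1$, and let $h_i=x_i-x_{i-1}$, $i=1,\dots,N$. If $h_N\le\min_{i=1,\dots,N-1}h_i$, then there exists an $L^1$-best approximation $u_h$ of $u\equiv1$ with $u_h(0)=1$ and $u_h(1)=0$ satisfying $u_h(x_i)=1$ for all $i=1,\dots,N-1$.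
   Context: For a given mesh (a subdivision of $(0,1)$ into finitely many disjoint open intervals), $U_h$ denotes the space of all continuous functions on $[0,1]$ that are affine (polynomials of degree at most one) on each interval of the mesh. For $1\le q<\infty$, an $L^q$-best approximation of $u$ with $u_h(0)=1$ and $u_h(1)=0$ is a function $u_h\in U_h$ with $u_h(0)=1$, $u_h(1)=0$ such that $\|u-u_h\|_{L^q((0,1))}\le\|u-v_h\|_{L^q((0,1))}$ for all $v_h\in U_h$ with $v_h(0)=1$, $v_h(1)=0$. *)

theory Defs
  imports "HOL-Analysis.Analysis"
begin

definition is_mesh :: "nat \<Rightarrow> (nat \<Rightarrow> real) \<Rightarrow> bool" where
  "is_mesh N x \<longleftrightarrow> x 0 = 0 \<and> x N = 1 \<and> (\<forall>i\<in>{1..N}. x (i - 1) < x i)"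

definition mesh_width :: "(nat \<Rightarrow> real) \<Rightarrow> nat \<Rightarrow> real" where
  "mesh_width x i = x i - x (i - 1)"

text \<open>Functions on $[0,1]$ are represented extensionally, so that equality of elements of the
  discrete space is equality on $[0,1]$.\<close>

definition Uh :: "nat \<Rightarrow> (nat \<Rightarrow> real) \<Rightarrow> (real \<Rightarrow> real) set" where
  "Uh N x = {v \<in> extensional {0..1}. continuous_on {0..1} v \<and>
     (\<forall>i\<in>{1..N}. \<exists>a b. \<forall>t\<in>{x (i - 1)<..<x i}. v t = a + b * t)}"

definition Lq_norm :: "real \<Rightarrow> (real \<Rightarrow> real) \<Rightarrow> real" where
  "Lq_norm q f = (LINT t:{0<..<1}|lborel. \<bar>f t\<bar> powr q) powr (1 / q)"

definition admissible :: "nat \<Rightarrow> (nat \<Rightarrow> real) \<Rightarrow> (real \<Rightarrow> real) set" where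
  "admissible N x = {v \<in> Uh N x. v 0 = 1 \<and> v 1 = 0}"

definition best_approximations ::
    "real \<Rightarrow> nat \<Rightarrow> (nat \<Rightarrow> real) \<Rightarrow> (real \<Rightarrow> real) \<Rightarrow> (real \<Rightarrow> real) set" where
  "best_approximations q N x u = {v \<in> admissible N x. \<forall>w\<in>admissible N x.
     Lq_norm q (\<lambda>t. u t - v t) \<le> Lq_norm q (\<lambda>t. u t - w t)}"

definition alpha_condition :: "real \<Rightarrow> real \<Rightarrow> real \<Rightarrow> bool" where
  "alpha_condition q h \<alpha> \<longleftrightarrow>
     (if q = 1 then \<alpha> = (if h \<le> 1 / 2 then 1 else sqrt (2 * h))
      else \<alpha> > 1 \<and>
        0 = - (1 - h) * \<alpha>\<^sup>2 * q * (\<alpha> - 1) powr (q - 1)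
            - h * (\<alpha> * q + 1) * (\<alpha> - 1) powr q + h)"

text \<open>The backward recursion for $\vartheta_N, \ldots, \vartheta_1$, with mesh widths \<open>h\<close>;
  \<open>None\<close> means undefined. Only the indices $1 \le i \le N$ are meaningful.\<close>

function theta :: "(nat \<Rightarrow> real) \<Rightarrow> nat \<Rightarrow> nat \<Rightarrow> real option" where
  "theta h N i =
     (if i \<ge> N then Some 0
      else case theta h N (i + 1) of
          None \<Rightarrow> None
        | Some t \<Rightarrow>
            (let r = 1 / 2 * (1 - (2 * (1 - t)\<^sup>2 - 1) * (h (i + 1) / h i))
             in if r < 0 then None else Some (sqrt r)))"
  by pat_completeness auto
termination
  by (relation "Wellfounded.measure (\<lambda>(h, N, i). N - i)") auto

declare theta.simps [simp del]

definition theta_index :: "(nat \<Rightarrow> real) \<Rightarrow> nat \<Rightarrow> nat" where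
  "theta_index h N =
     Max ({0} \<union> {i \<in> {1..N - 1}. \<exists>t. theta h N i = Some t \<and> t \<ge> 1 - 1 / sqrt 2})"

end

theory Submission
  imports Defs
begin

text \<open>
  On a mesh with two intervals an admissible function is determined by its value \<open>\<beta>\<close> at the interior
  node. Lowering \<open>\<beta>\<close> below \<open>1\<close> enlarges the error pointwise. For \<open>\<beta> \<ge> 1\<close> the integral of the
  \<open>q\<close>-th power of the error has a closed form, because \<open>\<bar>x\<bar> powr q\<close> has an elementary
  antiderivative. Up to a positive factor its derivative in \<open>\<beta>\<close> is strictly increasing, and the
  condition on \<open>\<alpha>\<close> locates its change of sign: at a zero, or, for \<open>q = 1\<close> and \<open>h \<le> 1 / 2\<close>, at the end
  point \<open>1\<close>. Hence \<open>\<alpha>\<close> is the unique minimiser (\<open>two_interval_best_approximations\<close>).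

  The two results on general meshes rest on duality in the mean. The candidate \<open>u\<close> equals \<open>1\<close> up to
  the last interior node and then falls to \<open>0\<close>, with error \<open>h\<^sub>N / 2\<close>. Let a multiplier \<open>s\<close> satisfy
  \<open>\<bar>s\<bar> \<le> 1\<close>, be equal to \<open>1\<close> on the last interval, and be orthogonal to the hat functions of all
  interior nodes. For every admissible \<open>w\<close> the function \<open>1 - w\<close> is piecewise linear with boundary
  values \<open>0\<close> and \<open>1\<close>, so its integral against \<open>s\<close> is \<open>h\<^sub>N / 2\<close>; this integral is at most the mean
  error of \<open>w\<close>, and \<open>u\<close> is optimal (\<open>kink_best_L1_approximation\<close>).

  It remains to find multipliers. All of them are taken, on the \<open>i\<close>-th interval, as \<open>- c\<^sub>i\<close> on the first
  fraction \<open>\<theta>\<^sub>i\<close> and \<open>c\<^sub>i\<close> on the rest, with \<open>\<theta>\<^sub>i\<close> in \<open>{0..1}\<close> and \<open>\<bar>c\<^sub>i\<bar> \<le> 1\<close>. If the last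
  interval is shortest, then \<open>\<theta>\<^sub>i = 0\<close> and constants of alternating sign and equal mass do. In
  general, the recursion for \<open>\<vartheta>\<^sub>i\<close> is the orthogonality condition for \<open>c\<^sub>i = \<plusminus>1\<close> with alternating
  signs and \<open>\<theta>\<^sub>i = \<vartheta>\<^sub>i\<close>. Once \<open>\<vartheta>\<^sub>i\<close> reaches \<open>1 - 1 / sqrt 2\<close>, the multiplier on that interval can be
  made orthogonal to the left hat function, and it may vanish on all intervals before.
\<close>

section \<open>Meshes and discrete functions\<close>

lemma mesh_less:
  assumes "is_mesh N x" "i < N"
  shows "x i < x (Suc i)"
  using assms by (force simp: is_mesh_def)

lemma mesh_mono:
  assumes "is_mesh N x" "i \<le> j" "j \<le> N"
  shows "x i \<le> x j"
  using assms(2,3)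
proof (induction j rule: dec_induct)
  case base
  then show ?case by simp
next
  case (step n)
  then show ?case using mesh_less[OF assms(1), of n] by simp
qed

lemma mesh_in_unit:
  assumes "is_mesh N x" "i \<le> N"
  shows "0 \<le> x i" "x i \<le> 1"
  using mesh_mono[OF assms(1), of 0 i] mesh_mono[OF assms(1), of i N] assms
  by (auto simp: is_mesh_def)

lemma last_interior_node:
  assumes "is_mesh N x" "2 \<le> N"
  shows "0 < x (N - 1)" "x (N - 1) < 1"
proof -
  have "1 \<le> N - 1" "Suc (N - 1) = N" using assms(2) by auto
  then show "0 < x (N - 1)" "x (N - 1) < 1"
    using mesh_less[OF assms(1), of 0] mesh_mono[OF assms(1), of 1 "N - 1"]
      mesh_less[OF assms(1), of "N - 1"] assms by (auto simp: is_mesh_def)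
qed

text \<open>The definition of \<^const>\<open>Uh\<close> says nothing about the nodes; continuity carries the affine
  formula from an open mesh interval to its closure.\<close>

lemma Uh_affine:
  assumes "is_mesh N x" "v \<in> Uh N x" "i < N" "t \<in> {x i..x (Suc i)}"
  shows "v t = v (x i) + (v (x (Suc i)) - v (x i)) / (x (Suc i) - x i) * (t - x i)"
proof -
  have lt: "x i < x (Suc i)" using mesh_less assms by blast
  obtain a b where ab: "\<And>t. t \<in> {x i<..<x (Suc i)} \<Longrightarrow> v t = a + b * t"
    using assms(2,3) unfolding Uh_def by force
  have sub: "{x i..x (Suc i)} \<subseteq> {0..1}"
    using mesh_in_unit[OF assms(1), of i] mesh_in_unit[OF assms(1), of "Suc i"] assms(3) by auto
  have "continuous_on {x i..x (Suc i)} (\<lambda>t. v t - (a + b * t))"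
    using assms(2) sub by (auto simp: Uh_def intro!: continuous_intros intro: continuous_on_subset)
  hence cl: "continuous_on (closure {x i<..<x (Suc i)}) (\<lambda>t. v t - (a + b * t))"
    using lt by (simp add: closure_greaterThanLessThan)
  have eq: "v t = a + b * t" if "t \<in> {x i..x (Suc i)}" for t
    using continuous_constant_on_closure[OF cl, of 0 t] ab that lt
    by (auto simp: closure_greaterThanLessThan)
  have "v (x (Suc i)) - v (x i) = b * (x (Suc i) - x i)"
    using eq[of "x i"] eq[of "x (Suc i)"] lt by (simp add: algebra_simps)
  hence "(v (x (Suc i)) - v (x i)) / (x (Suc i) - x i) = b"
    using lt by simp
  then show ?thesis
    using eq[OF assms(4)] eq[of "x i"] lt by (simp add: algebra_simps)
qed

text \<open>The admissible function with a single kink, of height \<open>\<alpha>\<close> at \<open>c\<close>. It is the general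
  competitor on a mesh with two intervals; for \<open>\<alpha> = 1\<close> and \<open>c\<close> the last interior node it is the
  candidate without over- and undershoots.\<close>

definition kink :: "real \<Rightarrow> real \<Rightarrow> real \<Rightarrow> real" where
  "kink c \<alpha> = restrict (\<lambda>t. if t \<le> c then 1 + (\<alpha> - 1) / c * t
                             else \<alpha> - \<alpha> / (1 - c) * (t - c)) {0..1}"

lemma kink_left: "0 \<le> t \<Longrightarrow> t \<le> c \<Longrightarrow> c < 1 \<Longrightarrow> kink c \<alpha> t = 1 + (\<alpha> - 1) / c * t"
  by (auto simp: kink_def)

lemma kink_right:
  "0 < c \<Longrightarrow> c \<le> t \<Longrightarrow> t \<le> 1 \<Longrightarrow> kink c \<alpha> t = \<alpha> - \<alpha> / (1 - c) * (t - c)"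
  by (cases "t = c") (auto simp: kink_def)

lemma kink_admissible:
  assumes "is_mesh N x" "2 \<le> N"
  shows "kink (x (N - 1)) \<alpha> \<in> admissible N x"
proof -
  define c where "c = x (N - 1)"
  have c: "0 < c" "c < 1"
    using last_interior_node[OF assms] by (simp_all add: c_def)
  have "continuous_on ({0..c} \<union> {c..1}) (\<lambda>t. if t \<le> c then 1 + (\<alpha> - 1) / c * t
                             else \<alpha> - \<alpha> / (1 - c) * (t - c))"
    using c by (intro continuous_on_If continuous_intros) (auto simp: field_simps)
  moreover have "{0..c} \<union> {c..1} = {0..1}" using c by auto
  ultimately have cont: "continuous_on {0..1} (kink c \<alpha>)"
    by (simp add: kink_def restrict_def cong: continuous_on_cong_simp)
  have aff: "\<exists>a b. \<forall>t\<in>{x (i - 1)<..<x i}. kink c \<alpha> t = a + b * t" if i: "i \<in> {1..N}" for i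
  proof (cases "i = N")
    case True
    hence "kink c \<alpha> t = (\<alpha> + \<alpha> / (1 - c) * c) + - (\<alpha> / (1 - c)) * t" if "t \<in> {x (i - 1)<..<x i}" for t
      using kink_right[of c t \<alpha>] c that assms(1) by (simp add: is_mesh_def c_def right_diff_distrib diff_divide_distrib)
    then show ?thesis by blast
  next
    case False
    hence "x i \<le> c" "0 \<le> x (i - 1)"
      using mesh_mono[OF assms(1), of i "N - 1"] mesh_in_unit[OF assms(1), of "i - 1"] i
      by (auto simp: c_def)
    hence "kink c \<alpha> t = 1 + (\<alpha> - 1) / c * t" if "t \<in> {x (i - 1)<..<x i}" for t
      using kink_left[of t c \<alpha>] c that by simp
    then show ?thesis by blast
  qed
  have "kink c \<alpha> \<in> Uh N x"
    using cont aff by (auto simp: Uh_def kink_def)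
  moreover have "kink c \<alpha> 0 = 1" "kink c \<alpha> 1 = 0"
    using kink_left[of 0 c \<alpha>] kink_right[of c 1 \<alpha>] c by simp_all
  ultimately show ?thesis by (simp add: admissible_def c_def)
qed

lemma admissible_two_kink:
  assumes "is_mesh 2 x" "v \<in> admissible 2 x"
  shows "v = kink (x 1) (v (x 1))"
proof
  fix t
  have x: "x 0 = 0" "x 2 = 1" using assms(1) by (auto simp: is_mesh_def)
  have c: "0 < x 1" "x 1 < 1"
    using mesh_less[OF assms(1), of 0] mesh_less[OF assms(1), of 1] x by (auto simp: numeral_2_eq_2)
  have v: "v \<in> Uh 2 x" "v 0 = 1" "v 1 = 0" using assms(2) by (auto simp: admissible_def)
  consider "t \<notin> {0..1}" | "t \<in> {0..x 1}" | "t \<in> {x 1..1}" by force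
  then show "v t = kink (x 1) (v (x 1)) t"
  proof cases
    case 1
    with v(1) show ?thesis by (auto simp: Uh_def kink_def extensional_def)
  next
    case 2
    then show ?thesis
      using Uh_affine[OF assms(1) v(1), of 0 t] x v c kink_left[of t "x 1"] by auto
  next
    case 3
    then show ?thesis
      using Uh_affine[OF assms(1) v(1), of 1 t] x v c kink_right[of "x 1" t]
      by (auto simp: numeral_2_eq_2)
  qed
qed

section \<open>The energy of a discrete function\<close>

lemma Lq_norm_eq_integral:
  assumes "continuous_on {0..1} f" "1 \<le> q"
  shows "Lq_norm q f = (integral {0..1} (\<lambda>t. \<bar>f t\<bar> powr q)) powr (1 / q)"
proof -
  have "continuous_on {0..1} (\<lambda>t. \<bar>f t\<bar> powr q)"
    using assms by (intro continuous_on_powr' continuous_intros) auto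
  hence "set_integrable lborel {0<..<1} (\<lambda>t. \<bar>f t\<bar> powr q)"
    by (intro set_integrable_subset[OF borel_integrable_atLeastAtMost']) auto
  from set_borel_integral_eq_integral(2)[OF this] show ?thesis
    by (simp add: Lq_norm_def integral_open_interval_real)
qed

lemma admissible_continuous:
  "v \<in> admissible N x \<Longrightarrow> continuous_on {0..1} v"
  by (simp add: admissible_def Uh_def)

text \<open>Taking the \<open>q\<close>-th root is strictly increasing, so norms may be compared through the integrals
  of the \<open>q\<close>-th powers.\<close>

lemma Lq_norm_error_le_iff:
  assumes "v \<in> admissible N x" "w \<in> admissible N x" "1 \<le> q"
  shows "Lq_norm q (\<lambda>t. 1 - v t) \<le> Lq_norm q (\<lambda>t. 1 - w t) \<longleftrightarrow>
    integral {0..1} (\<lambda>t. \<bar>1 - v t\<bar> powr q) \<le> integral {0..1} (\<lambda>t. \<bar>1 - w t\<bar> powr q)"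
proof -
  have eq: "Lq_norm q (\<lambda>t. 1 - u t) = (integral {0..1} (\<lambda>t. \<bar>1 - u t\<bar> powr q)) powr (1 / q)"
    if "u \<in> admissible N x" for u
    using admissible_continuous[OF that] assms(3)
    by (intro Lq_norm_eq_integral continuous_intros) auto
  have nonneg: "0 \<le> integral {0..1} (\<lambda>t. \<bar>1 - u t\<bar> powr q)" for u :: "real \<Rightarrow> real"
  proof (cases "(\<lambda>t. \<bar>1 - u t\<bar> powr q) integrable_on {0..1}")
    case True
    then show ?thesis by (rule integral_nonneg) simp
  next
    case False
    then show ?thesis by (simp add: not_integrable_integral)
  qed
  show ?thesis
    unfolding eq[OF assms(1)] eq[OF assms(2)]
    using nonneg[of v] nonneg[of w] assms(3)
      powr_less_mono2[of "1 / q" "integral {0..1} (\<lambda>t. \<bar>1 - w t\<bar> powr q)"]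
      powr_mono2[of "1 / q" "integral {0..1} (\<lambda>t. \<bar>1 - v t\<bar> powr q)"]
    by (smt (verit) divide_pos_pos)
qed

text \<open>\<open>x * \<bar>x\<bar> powr q / (q + 1)\<close> is an antiderivative of \<open>\<bar>x\<bar> powr q\<close> on both sides of the origin
  simultaneously, so that sign changes of the affine function need no separate treatment.\<close>

lemma abs_powr_affine_has_integral:
  fixes l r p s q :: real
  assumes "l \<le> r" "s \<noteq> 0" "1 \<le> q"
  shows "((\<lambda>t. \<bar>p + s * (t - l)\<bar> powr q) has_integral
    ((p + s * (r - l)) * \<bar>p + s * (r - l)\<bar> powr q - p * \<bar>p\<bar> powr q) / (s * (q + 1))) {l..r}"
proof -
  define F where "F t = (p + s * (t - l)) * \<bar>p + s * (t - l)\<bar> powr q / (s * (q + 1))" for t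
  have "((\<lambda>t. \<bar>p + s * (t - l)\<bar> powr q) has_integral F r - F l) {l..r}"
  proof (rule fundamental_theorem_of_calculus_strong)
    show "finite {l - p / s}" "l \<le> r" using assms by auto
    show "continuous_on {l..r} F"
      unfolding F_def using assms by (intro continuous_intros continuous_on_powr') auto
    show "(F has_vector_derivative \<bar>p + s * (t - l)\<bar> powr q) (at t)"
      if t: "t \<in> {l..r} - {l - p / s}" for t
    proof -
      have nz: "p + s * (t - l) \<noteq> 0"
        using t assms(2) by (auto simp: field_simps)
      have dp: "((\<lambda>y. y * \<bar>y\<bar> powr q) has_real_derivative (q + 1) * \<bar>y\<bar> powr q) (at y)"
        if "y \<noteq> 0" for y :: real
      proof (cases "y > 0")
        case True
        have "((\<lambda>y. y * y powr q) has_real_derivative (q + 1) * \<bar>y\<bar> powr q) (at y)"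
          using True by (auto intro!: derivative_eq_intros simp: powr_diff field_simps)
        then show ?thesis
          by (rule DERIV_cong_ev[THEN iffD1, rotated 3])
            (use True eventually_nhds_in_open[of "{0<..}" y] in \<open>auto elim!: eventually_mono\<close>)
      next
        case False
        hence "y < 0" using that by simp
        have "((\<lambda>y. y * (- y) powr q) has_real_derivative (q + 1) * \<bar>y\<bar> powr q) (at y)"
          using \<open>y < 0\<close> by (auto intro!: derivative_eq_intros simp: powr_diff field_simps)
        then show ?thesis
          by (rule DERIV_cong_ev[THEN iffD1, rotated 3])
            (use \<open>y < 0\<close> eventually_nhds_in_open[of "{..<0}" y] in \<open>auto elim!: eventually_mono\<close>)
      qed
      have "((\<lambda>t. p + s * (t - l)) has_real_derivative s) (at t)"
        by (auto intro!: derivative_eq_intros)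
      from DERIV_chain2[OF dp[OF nz] this]
      have "((\<lambda>t. (p + s * (t - l)) * \<bar>p + s * (t - l)\<bar> powr q) has_real_derivative
          (q + 1) * \<bar>p + s * (t - l)\<bar> powr q * s) (at t)" .
      from DERIV_cdivide[OF this, of "s * (q + 1)"]
      have "(F has_real_derivative \<bar>p + s * (t - l)\<bar> powr q) (at t)"
        using assms by (simp add: F_def[abs_def] mult.commute)
      thus ?thesis by (simp add: has_real_derivative_iff_has_vector_derivative)
    qed
  qed
  thus ?thesis by (simp add: F_def diff_divide_distrib)
qed

text \<open>The integral of \<open>\<bar>1 - v\<bar> powr q\<close> for \<open>v = kink (1 - h) \<beta>\<close> and \<open>\<beta> \<ge> 1\<close>.\<close>

definition kink_energy :: "real \<Rightarrow> real \<Rightarrow> real \<Rightarrow> real" where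
  "kink_energy q h \<beta> = (1 - h) * (\<beta> - 1) powr q / (q + 1)
     + h * (1 + (\<beta> - 1) * (\<beta> - 1) powr q) / (\<beta> * (q + 1))"

lemma kink_integral_left:
  assumes "0 < h" "h < 1" "1 \<le> q"
  shows "((\<lambda>t. \<bar>1 - kink (1 - h) \<beta> t\<bar> powr q) has_integral
    (1 - h) * \<bar>\<beta> - 1\<bar> powr q / (q + 1)) {0..1 - h}"
proof (cases "\<beta> = 1")
  case True
  have "((\<lambda>t. \<bar>1 - kink (1 - h) \<beta> t\<bar> powr q) has_integral 0) {0..1 - h}"
    by (rule has_integral_eq[of _ "\<lambda>_. 0"]) (use True assms kink_left in auto)
  then show ?thesis using True by simp
next
  case False
  define s where "s = (1 - \<beta>) / (1 - h)"
  have s: "s \<noteq> 0" "s * (1 - h) = 1 - \<beta>" using False assms by (auto simp: s_def)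
  have "((\<lambda>t. \<bar>0 + s * (t - 0)\<bar> powr q) has_integral
      ((0 + s * (1 - h - 0)) * \<bar>0 + s * (1 - h - 0)\<bar> powr q - 0 * \<bar>0\<bar> powr q) / (s * (q + 1))) {0..1 - h}"
    using s assms by (intro abs_powr_affine_has_integral) auto
  also have "((0 + s * (1 - h - 0)) * \<bar>0 + s * (1 - h - 0)\<bar> powr q - 0 * \<bar>0\<bar> powr q) / (s * (q + 1))
      = (1 - h) * \<bar>\<beta> - 1\<bar> powr q / (q + 1)"
  proof -
    define B where "B = \<bar>\<beta> - 1\<bar> powr q"
    have "\<bar>1 - \<beta>\<bar> powr q = B" by (simp add: B_def abs_minus_commute)
    moreover have "(1 - \<beta>) * B / (s * (q + 1)) = (1 - h) * B / (q + 1)"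
      using s(1) by (simp add: s(2)[symmetric])
    ultimately show ?thesis by (simp add: s(2) B_def[symmetric])
  qed
  finally show ?thesis
    by (rule has_integral_eq[rotated])
      (use assms in \<open>auto simp: kink_left s_def diff_divide_distrib algebra_simps\<close>)
qed

lemma kink_integral_right:
  assumes "0 < h" "h < 1" "1 \<le> q" "1 \<le> \<beta>"
  shows "((\<lambda>t. \<bar>1 - kink (1 - h) \<beta> t\<bar> powr q) has_integral
    h * (1 + (\<beta> - 1) * (\<beta> - 1) powr q) / (\<beta> * (q + 1))) {1 - h..1}"
proof -
  define s where "s = \<beta> / h"
  have s: "s \<noteq> 0" "s * h = \<beta>" using assms by (auto simp: s_def)
  have "((\<lambda>t. \<bar>(1 - \<beta>) + s * (t - (1 - h))\<bar> powr q) has_integral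
      (((1 - \<beta>) + s * (1 - (1 - h))) * \<bar>(1 - \<beta>) + s * (1 - (1 - h))\<bar> powr q
        - (1 - \<beta>) * \<bar>1 - \<beta>\<bar> powr q) / (s * (q + 1))) {1 - h..1}"
    using s assms by (intro abs_powr_affine_has_integral) auto
  also have "(((1 - \<beta>) + s * (1 - (1 - h))) * \<bar>(1 - \<beta>) + s * (1 - (1 - h))\<bar> powr q
        - (1 - \<beta>) * \<bar>1 - \<beta>\<bar> powr q) / (s * (q + 1))
      = h * (1 + (\<beta> - 1) * (\<beta> - 1) powr q) / (\<beta> * (q + 1))"
    using s assms by (simp add: s_def field_simps)
  finally show ?thesis
    by (rule has_integral_eq[rotated])
      (use assms in \<open>auto simp: kink_right s_def algebra_simps\<close>)
qed

lemma kink_integral_ge_one: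
  assumes "0 < h" "h < 1" "1 \<le> q" "1 \<le> \<beta>"
  shows "integral {0..1} (\<lambda>t. \<bar>1 - kink (1 - h) \<beta> t\<bar> powr q) = kink_energy q h \<beta>"
  using has_integral_combine[OF _ _ kink_integral_left kink_integral_right, of h q \<beta>] assms
  by (simp add: kink_energy_def integral_unique)

text \<open>Lowering the nodal value below the boundary value \<open>1\<close> increases the error pointwise.\<close>

lemma kink_integral_less_one:
  assumes h: "0 < h" "h < 1" and q: "1 \<le> q" and \<beta>: "\<beta> < 1"
  shows "kink_energy q h 1 < integral {0..1} (\<lambda>t. \<bar>1 - kink (1 - h) \<beta> t\<bar> powr q)"
proof -
  let ?f = "\<lambda>\<beta> t. \<bar>1 - kink (1 - h) \<beta> t\<bar> powr q"
  have right: "?f \<beta> t = \<bar>1 - \<beta> * ((1 - t) / h)\<bar> powr q" if "t \<in> {1 - h..1}" for \<beta> t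
  proof -
    have "kink (1 - h) \<beta> t = \<beta> * ((1 - t) / h)"
      using that h kink_right[of "1 - h" t \<beta>] by (simp add: field_simps)
    then show ?thesis by simp
  qed
  have int: "?f \<beta> integrable_on {1 - h..1}" for \<beta>
  proof -
    have "continuous_on {1 - h..1} (\<lambda>t. \<bar>1 - \<beta> * ((1 - t) / h)\<bar> powr q)"
      using h q by (intro continuous_on_powr' continuous_intros) auto
    hence "(\<lambda>t. \<bar>1 - \<beta> * ((1 - t) / h)\<bar> powr q) integrable_on {1 - h..1}"
      by (rule integrable_continuous_real)
    then show ?thesis by (rule integrable_eq) (use right in auto)
  qed
  have le: "integral {1 - h..1} (?f 1) \<le> integral {1 - h..1} (?f \<beta>)"
  proof (intro integral_le int)
    fix t assume t: "t \<in> {1 - h..1}"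
    define y where "y = (1 - t) / h"
    have y: "0 \<le> y" "y \<le> 1" using t h by (auto simp: y_def field_simps)
    have "\<beta> * y \<le> 1 * y" using \<beta> y by (intro mult_right_mono) auto
    hence "\<bar>1 - 1 * y\<bar> \<le> \<bar>1 - \<beta> * y\<bar>" using y by linarith
    then show "?f 1 t \<le> ?f \<beta> t"
      using q by (simp add: right[OF t] y_def[symmetric] powr_mono2)
  qed
  have "((?f \<beta>) has_integral (1 - h) * \<bar>\<beta> - 1\<bar> powr q / (q + 1) + integral {1 - h..1} (?f \<beta>)) {0..1}"
    using h q int by (intro has_integral_combine[of 0 "1 - h" 1] kink_integral_left integrable_integral) auto
  moreover have "((?f 1) has_integral 0 + integral {1 - h..1} (?f 1)) {0..1}"
    using h q int kink_integral_left[of h q 1]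
    by (intro has_integral_combine[of 0 "1 - h" 1] integrable_integral) auto
  moreover have "0 < (1 - h) * \<bar>\<beta> - 1\<bar> powr q / (q + 1)"
    using h q \<beta> by simp
  ultimately show ?thesis
    using le kink_integral_ge_one[of h q 1] h q by (auto dest!: integral_unique)
qed

section \<open>Two intervals\<close>

text \<open>The derivative of \<^const>\<open>kink_energy\<close>, up to the positive factor \<open>1 / ((q + 1) * \<beta>\<^sup>2)\<close>; the
  equation for the optimal nodal value says that it vanishes.\<close>

definition energy_slope :: "real \<Rightarrow> real \<Rightarrow> real \<Rightarrow> real" where
  "energy_slope q h \<beta> = (1 - h) * \<beta>\<^sup>2 * q * (\<beta> - 1) powr (q - 1)
     + h * (\<beta> * q + 1) * (\<beta> - 1) powr q - h"

lemma kink_energy_DERIV: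
  assumes "1 < \<beta>" "1 \<le> q"
  shows "(kink_energy q h has_real_derivative energy_slope q h \<beta> / ((q + 1) * \<beta>\<^sup>2)) (at \<beta>)"
proof -
  define P where "P = (\<beta> - 1) powr (q - 1)"
  have P: "(\<beta> - 1) powr q = (\<beta> - 1) * P"
    using assms by (simp add: P_def powr_mult_base)
  show ?thesis
    unfolding kink_energy_def[abs_def]
    using assms
    apply (auto intro!: derivative_eq_intros simp: P_def[symmetric])
    apply (simp add: energy_slope_def P P_def[symmetric] power2_eq_square)
    apply (simp add: divide_simps)
    apply (simp add: algebra_simps)
    done
qed

lemma continuous_on_kink_energy:
  assumes "1 \<le> q" "S \<subseteq> {1..}"
  shows "continuous_on S (kink_energy q h)"
  unfolding kink_energy_def[abs_def]
  using assms by (intro continuous_intros continuous_on_powr') auto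

text \<open>Hence the slope is negative before and positive after any zero to the right of \<open>1\<close>, which makes
  the energy strictly decreasing before and strictly increasing after that zero.\<close>

lemma energy_slope_strict_mono:
  assumes "0 < h" "h < 1" "1 \<le> q" "1 < \<beta>" "\<beta> < \<gamma>"
  shows "energy_slope q h \<beta> < energy_slope q h \<gamma>"
proof -
  have "\<beta>\<^sup>2 < \<gamma>\<^sup>2" using assms by (intro power_strict_mono) auto
  hence "(1 - h) * q * \<beta>\<^sup>2 * (\<beta> - 1) powr (q - 1) < (1 - h) * q * \<gamma>\<^sup>2 * (\<gamma> - 1) powr (q - 1)"
    using assms by (intro mult_less_le_imp_less mult_strict_left_mono powr_mono2) auto
  moreover have "h * (\<beta> * q + 1) * (\<beta> - 1) powr q \<le> h * (\<gamma> * q + 1) * (\<gamma> - 1) powr q"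
    using assms by (intro mult_mono powr_mono2) auto
  ultimately show ?thesis by (simp add: energy_slope_def mult_ac)
qed

lemma energy_slope_one: "1 < \<beta> \<Longrightarrow> energy_slope 1 h \<beta> = \<beta>\<^sup>2 - 2 * h"
  by (simp add: energy_slope_def power2_eq_square algebra_simps)

lemma alpha_condition_iff_slope:
  assumes "q \<noteq> 1"
  shows "alpha_condition q h \<alpha> \<longleftrightarrow> 1 < \<alpha> \<and> energy_slope q h \<alpha> = 0"
  using assms by (auto simp: alpha_condition_def energy_slope_def algebra_simps)

text \<open>For \<open>q > 1\<close> the slope is continuous on \<open>{1..}\<close>, negative at \<open>1\<close> and nonnegative at \<open>2\<close>.\<close>

lemma ex_alpha_condition:
  assumes "0 < h" "h < 1" "1 \<le> q"
  shows "\<exists>\<alpha>. alpha_condition q h \<alpha>"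
proof (cases "q = 1")
  case True
  then show ?thesis by (auto simp: alpha_condition_def)
next
  case False
  have "continuous_on {1..2} (energy_slope q h)"
    unfolding energy_slope_def[abs_def] using assms False
    by (intro continuous_intros continuous_on_powr') auto
  moreover have one: "energy_slope q h 1 < 0"
    using assms by (simp add: energy_slope_def)
  moreover have "0 \<le> energy_slope q h 2"
    using assms by (simp add: energy_slope_def algebra_simps)
  ultimately obtain \<alpha> where "1 \<le> \<alpha>" "energy_slope q h \<alpha> = 0"
    using IVT'[of "energy_slope q h" 1 0 2] by auto
  moreover from this one have "\<alpha> \<noteq> 1" by auto
  ultimately show ?thesis
    using False alpha_condition_iff_slope[of q h \<alpha>] by auto
qed

text \<open>The two definitions of the nodal value, for \<open>q = 1\<close> and for \<open>q > 1\<close>, have this sign change in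
  common. For \<open>q = 1\<close> the slope is \<open>\<beta>\<^sup>2 - 2 * h\<close> on \<open>\<beta> > 1\<close>, so it is positive there as soon as
  \<open>h \<le> 1 / 2\<close>, and the minimum sits at the end point \<open>1\<close>.\<close>

lemma alpha_condition_slope_sign:
  assumes "0 < h" "h < 1" "1 \<le> q" "alpha_condition q h \<alpha>"
  shows "1 \<le> \<alpha>"
    and "1 < \<beta> \<Longrightarrow> \<beta> < \<alpha> \<Longrightarrow> energy_slope q h \<beta> < 0"
    and "\<alpha> < \<beta> \<Longrightarrow> 0 < energy_slope q h \<beta>"
proof -
  have *: "1 \<le> \<alpha> \<and> (1 < \<beta> \<longrightarrow> \<beta> < \<alpha> \<longrightarrow> energy_slope q h \<beta> < 0) \<and>
      (\<alpha> < \<beta> \<longrightarrow> 0 < energy_slope q h \<beta>)"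
  proof (cases "q = 1")
    case False
    then have "1 < \<alpha>" "energy_slope q h \<alpha> = 0"
      using assms by (auto simp: alpha_condition_iff_slope)
    then show ?thesis
      using energy_slope_strict_mono[of h q \<alpha> \<beta>] energy_slope_strict_mono[of h q \<beta> \<alpha>] assms by auto
  next
    case True
    show ?thesis
    proof (cases "h \<le> 1 / 2")
      case True
      hence a: "\<alpha> = 1" using \<open>q = 1\<close> assms by (simp add: alpha_condition_def)
      have "0 < energy_slope q h \<beta>" if "1 < \<beta>"
      proof -
        have "1 < \<beta>\<^sup>2" using that by (simp add: one_less_power)
        with True have "0 < \<beta>\<^sup>2 - 2 * h" by linarith
        then show ?thesis using that \<open>q = 1\<close> by (simp add: energy_slope_one)
      qed
      then show ?thesis using a by auto
    next
      case False
      hence a: "1 \<le> \<alpha>" "\<alpha>\<^sup>2 = 2 * h" using \<open>q = 1\<close> assms by (auto simp: alpha_condition_def)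
      then show ?thesis
        using \<open>q = 1\<close> power_strict_mono[of \<alpha> \<beta> 2] power_strict_mono[of \<beta> \<alpha> 2]
        by (auto simp: energy_slope_one)
    qed
  qed
  show "1 \<le> \<alpha>"
    and "1 < \<beta> \<Longrightarrow> \<beta> < \<alpha> \<Longrightarrow> energy_slope q h \<beta> < 0"
    and "\<alpha> < \<beta> \<Longrightarrow> 0 < energy_slope q h \<beta>"
    using * by auto
qed

lemma kink_energy_strict_min:
  assumes "0 < h" "h < 1" "1 \<le> q" "alpha_condition q h \<alpha>" "1 \<le> \<beta>" "\<beta> \<noteq> \<alpha>"
  shows "kink_energy q h \<alpha> < kink_energy q h \<beta>"
proof (cases "\<beta> < \<alpha>")
  case True
  show ?thesis
  proof (rule DERIV_neg_imp_decreasing_open[where f = "kink_energy q h", OF True])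
    show "continuous_on {\<beta>..\<alpha>} (kink_energy q h)"
      using assms by (intro continuous_on_kink_energy) auto
    show "\<exists>y. DERIV (kink_energy q h) t :> y \<and> y < 0" if "\<beta> < t" "t < \<alpha>" for t
      using kink_energy_DERIV[of t q h] alpha_condition_slope_sign(2)[OF assms(1-4), of t] that assms
      by (intro exI[of _ "energy_slope q h t / ((q + 1) * t\<^sup>2)"]) (auto simp: divide_neg_pos)
  qed
next
  case False
  have \<alpha>: "1 \<le> \<alpha>" using alpha_condition_slope_sign(1)[OF assms(1-4)] .
  show ?thesis
  proof (rule DERIV_pos_imp_increasing_open[where f = "kink_energy q h"])
    show "\<alpha> < \<beta>" using False assms by simp
    show "continuous_on {\<alpha>..\<beta>} (kink_energy q h)"
      using assms \<alpha> by (intro continuous_on_kink_energy) auto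
    show "\<exists>y. DERIV (kink_energy q h) t :> y \<and> 0 < y" if "\<alpha> < t" "t < \<beta>" for t
      using kink_energy_DERIV[of t q h] alpha_condition_slope_sign(3)[OF assms(1-4), of t] that assms \<alpha>
      by (intro exI[of _ "energy_slope q h t / ((q + 1) * t\<^sup>2)"]) auto
  qed
qed

lemma kink_integral_strict_min:
  assumes "0 < h" "h < 1" "1 \<le> q" "alpha_condition q h \<alpha>" "\<beta> \<noteq> \<alpha>"
  shows "integral {0..1} (\<lambda>t. \<bar>1 - kink (1 - h) \<alpha> t\<bar> powr q)
    < integral {0..1} (\<lambda>t. \<bar>1 - kink (1 - h) \<beta> t\<bar> powr q)"
proof -
  have \<alpha>: "1 \<le> \<alpha>" using alpha_condition_slope_sign(1)[OF assms(1-4)] .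
  \<comment> \<open>The value 1 separates the two regimes: below it the error exceeds the one at 1, above it the
      energy formula applies.\<close>
  have min1: "kink_energy q h \<alpha> \<le> kink_energy q h 1"
    using kink_energy_strict_min[OF assms(1-4), of 1] by (cases "\<alpha> = 1") auto
  show ?thesis
  proof (cases "1 \<le> \<beta>")
    case True
    then show ?thesis
      using kink_energy_strict_min[OF assms(1-4) True] assms \<alpha> by (simp add: kink_integral_ge_one)
  next
    case False
    then show ?thesis
      using kink_integral_less_one[of h q \<beta>] min1 assms \<alpha> by (simp add: kink_integral_ge_one)
  qed
qed

lemma two_interval_best_approximations:
  assumes h: "0 < h" "h < 1" and q: "1 \<le> q" and x: "is_mesh 2 x" "x 1 = 1 - h"
    and \<alpha>: "alpha_condition q h \<alpha>"
  shows "best_approximations q 2 x (\<lambda>_. 1) = {kink (1 - h) \<alpha>}"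
proof -
  let ?u = "kink (1 - h) \<alpha>"
  have adm: "kink (1 - h) \<beta> \<in> admissible 2 x" for \<beta>
    using kink_admissible[OF x(1), of \<beta>] x(2) by simp
  have less: "integral {0..1} (\<lambda>t. \<bar>1 - ?u t\<bar> powr q) < integral {0..1} (\<lambda>t. \<bar>1 - w t\<bar> powr q)"
    if "w \<in> admissible 2 x" "w \<noteq> ?u" for w
    using admissible_two_kink[OF x(1) that(1)] kink_integral_strict_min[OF h q \<alpha>, of "w (1 - h)"]
      that(2) x(2) by auto
  have min: "?u \<in> best_approximations q 2 x (\<lambda>_. 1)"
    unfolding best_approximations_def mem_Collect_eq
  proof (intro conjI ballI adm)
    fix w assume "w \<in> admissible 2 x"
    then show "Lq_norm q (\<lambda>t. 1 - ?u t) \<le> Lq_norm q (\<lambda>t. 1 - w t)"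
      using less[of w] Lq_norm_error_le_iff[OF adm _ q, of w \<alpha>] by (cases "w = ?u") auto
  qed
  moreover have "w = ?u" if "w \<in> best_approximations q 2 x (\<lambda>_. 1)" for w
  proof (rule ccontr)
    assume "w \<noteq> ?u"
    moreover have "w \<in> admissible 2 x" "Lq_norm q (\<lambda>t. 1 - w t) \<le> Lq_norm q (\<lambda>t. 1 - ?u t)"
      using that adm by (auto simp: best_approximations_def)
    ultimately show False
      using less[of w] Lq_norm_error_le_iff[OF _ adm q, of w \<alpha>] by simp
  qed
  ultimately show ?thesis by blast
qed

section \<open>Optimality in the mean by duality\<close>

lemma affine_has_integral:
  fixes l p s a b :: real
  assumes "a \<le> b"
  shows "((\<lambda>t. p + s * (t - l)) has_integral (b - a) * (p + s * ((a + b) / 2 - l))) {a..b}"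
proof -
  have "((\<lambda>t. p + s * (t - l)) has_integral
      (p * b + s * (b - l)\<^sup>2 / 2) - (p * a + s * (a - l)\<^sup>2 / 2)) {a..b}"
    by (rule fundamental_theorem_of_calculus[OF assms])
      (auto intro!: derivative_eq_intros simp: has_real_derivative_iff_has_vector_derivative[symmetric])
  also have "(p * b + s * (b - l)\<^sup>2 / 2) - (p * a + s * (a - l)\<^sup>2 / 2)
      = (b - a) * (p + s * ((a + b) / 2 - l))"
    by (simp add: power2_eq_square field_simps)
  finally show ?thesis .
qed

text \<open>The left-hand side is the integral of the affine function against the multiplier that equals
  \<open>- c\<close> on the first fraction \<open>\<theta>\<close> of the interval and \<open>c\<close> on the rest, written in terms of the two
  end values of the affine function.\<close>

lemma affine_L1_lower_bound:
  fixes e :: "real \<Rightarrow> real"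
  assumes lr: "l \<le> r" and e: "\<And>t. t \<in> {l..r} \<Longrightarrow> e t = p + s * (t - l)"
    and \<theta>: "0 \<le> \<theta>" "\<theta> \<le> 1" and c: "\<bar>c\<bar> \<le> 1"
  shows "c * (r - l) * ((1 - \<theta>)\<^sup>2 - 1 / 2) * e l + c * (r - l) * (1 / 2 - \<theta>\<^sup>2) * e r
    \<le> integral {l..r} (\<lambda>t. \<bar>e t\<bar>)"
proof -
  define m where "m = l + \<theta> * (r - l)"
  have "\<theta> * (r - l) \<le> 1 * (r - l)" using lr \<theta> by (intro mult_right_mono) auto
  hence m: "l \<le> m" "m \<le> r" using lr \<theta> by (auto simp: m_def)
  let ?I = "\<lambda>a b. (b - a) * (p + s * ((a + b) / 2 - l))"
  have hi: "(e has_integral ?I a b) {a..b}" if "l \<le> a" "a \<le> b" "b \<le> r" for a b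
    by (rule has_integral_eq[OF _ affine_has_integral[OF that(2)]]) (use e that in auto)
  have ce: "continuous_on {l..r} e"
  proof (rule continuous_on_eq)
    show "continuous_on {l..r} (\<lambda>t. p + s * (t - l))" by (intro continuous_intros)
  qed (use e in auto)
  hence ai: "(\<lambda>t. \<bar>e t\<bar>) integrable_on {l..r}"
    by (intro integrable_continuous_real continuous_intros)
  have bound: "\<bar>?I a b\<bar> \<le> integral {a..b} (\<lambda>t. \<bar>e t\<bar>)" if "l \<le> a" "a \<le> b" "b \<le> r" for a b
  proof -
    have "norm (integral {a..b} e) \<le> integral {a..b} (\<lambda>t. norm (e t))"
    proof (rule integral_norm_bound_integral)
      show "e integrable_on {a..b}" using hi[OF that] by blast
      show "(\<lambda>t. norm (e t)) integrable_on {a..b}"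
        using ce that by (auto intro!: integrable_continuous_real continuous_intros
            intro: continuous_on_subset)
    qed simp
    then show ?thesis using integral_unique[OF hi[OF that]] by simp
  qed
  have ends: "e l = p" "e r = p + s * (r - l)" using e lr by auto
  have "c * (r - l) * ((1 - \<theta>)\<^sup>2 - 1 / 2) * e l + c * (r - l) * (1 / 2 - \<theta>\<^sup>2) * e r
      = c * (?I m r - ?I l m)"
    unfolding ends m_def by (simp add: power2_eq_square field_simps)
  also have "\<dots> \<le> \<bar>c\<bar> * \<bar>?I m r - ?I l m\<bar>"
    by (metis abs_ge_self abs_mult)
  also have "\<dots> \<le> 1 * \<bar>?I m r - ?I l m\<bar>"
    using c by (intro mult_right_mono) auto
  also have "\<dots> \<le> integral {l..m} (\<lambda>t. \<bar>e t\<bar>) + integral {m..r} (\<lambda>t. \<bar>e t\<bar>)"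
  proof -
    have "\<bar>?I m r - ?I l m\<bar> \<le> \<bar>?I m r\<bar> + \<bar>?I l m\<bar>" by (rule abs_triangle_ineq4)
    also have "\<dots> \<le> integral {m..r} (\<lambda>t. \<bar>e t\<bar>) + integral {l..m} (\<lambda>t. \<bar>e t\<bar>)"
      by (intro add_mono bound m order_refl)
    finally show ?thesis unfolding mult_1_left by (rule ord_le_eq_trans[OF _ add.commute])
  qed
  also have "\<dots> = integral {l..r} (\<lambda>t. \<bar>e t\<bar>)"
    using m ai by (rule Henstock_Kurzweil_Integration.integral_combine)
  finally show ?thesis .
qed

text \<open>The moments of a multiplier, jumping after the fraction \<open>\<theta>\<close> and of height \<open>c\<close>, on a mesh
  interval of width \<open>h\<close> against the hat functions of the left and of the right end point.\<close>

definition left_moment :: "real \<Rightarrow> real \<Rightarrow> real \<Rightarrow> real" where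
  "left_moment h c \<theta> = c * h * ((1 - \<theta>)\<^sup>2 - 1 / 2)"

definition right_moment :: "real \<Rightarrow> real \<Rightarrow> real \<Rightarrow> real" where
  "right_moment h c \<theta> = c * h * (1 / 2 - \<theta>\<^sup>2)"

text \<open>If a multiplier bounded by \<open>1\<close> is orthogonal to all interior hat functions, then the integral
  of the error against it sees only the prescribed boundary values. Accumulating the intervals from
  the left, the orthogonality cancels the contribution of one interior node after the other.\<close>

lemma L1_error_lower_bound:
  assumes mesh: "is_mesh N x" and w: "w \<in> admissible N x" and N: "1 \<le> N"
    and mult: "\<And>i. i \<in> {1..N} \<Longrightarrow> 0 \<le> \<theta> i \<and> \<theta> i \<le> 1 \<and> \<bar>c i\<bar> \<le> 1"
    and last: "c N = 1" "\<theta> N = 0"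
    and orth: "\<And>i. i \<in> {1..N - 1} \<Longrightarrow> right_moment (mesh_width x i) (c i) (\<theta> i)
        + left_moment (mesh_width x (Suc i)) (c (Suc i)) (\<theta> (Suc i)) = 0"
  shows "mesh_width x N / 2 \<le> integral {0..1} (\<lambda>t. \<bar>1 - w t\<bar>)"
proof -
  let ?h = "mesh_width x"
  define e where "e t = 1 - w t" for t
  have w': "w \<in> Uh N x" "w 0 = 1" "w 1 = 0" using w by (auto simp: admissible_def)
  have x: "x 0 = 0" "x N = 1" using mesh by (auto simp: is_mesh_def)
  have ci: "(\<lambda>t. \<bar>e t\<bar>) integrable_on {0..b}" if "b \<le> 1" for b
    unfolding e_def using admissible_continuous[OF w] that
    by (intro integrable_continuous_real continuous_intros) (auto intro: continuous_on_subset)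
  have local: "left_moment (?h (Suc i)) (c (Suc i)) (\<theta> (Suc i)) * e (x i)
      + right_moment (?h (Suc i)) (c (Suc i)) (\<theta> (Suc i)) * e (x (Suc i))
      \<le> integral {x i..x (Suc i)} (\<lambda>t. \<bar>e t\<bar>)" if "i < N" for i
  proof -
    have lin: "e t = e (x i) + (e (x (Suc i)) - e (x i)) / (x (Suc i) - x i) * (t - x i)"
      if "t \<in> {x i..x (Suc i)}" for t
    proof -
      have "e (x (Suc i)) - e (x i) = - (w (x (Suc i)) - w (x i))" by (simp add: e_def)
      then show ?thesis
        using Uh_affine[OF mesh w'(1) \<open>i < N\<close> that]
        by (simp only: minus_divide_left[symmetric] e_def)
    qed
    have "x i \<le> x (Suc i)" using mesh_less[OF mesh that] by simp
    from affine_L1_lower_bound[of "x i" "x (Suc i)" e "e (x i)" _ "\<theta> (Suc i)" "c (Suc i)", OF this lin]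
    show ?thesis
      using mult[of "Suc i"] that
      by (simp add: left_moment_def right_moment_def mesh_width_def)
  qed
  have "right_moment (?h n) (c n) (\<theta> n) * e (x n) \<le> integral {0..x n} (\<lambda>t. \<bar>e t\<bar>)"
    if "1 \<le> n" "n \<le> N" for n
    using that
  proof (induction n rule: dec_induct)
    case base
    then show ?case using local[of 0] x w' by (simp add: e_def)
  next
    case (step n)
    have "integral {0..x n} (\<lambda>t. \<bar>e t\<bar>) + integral {x n..x (Suc n)} (\<lambda>t. \<bar>e t\<bar>)
        = integral {0..x (Suc n)} (\<lambda>t. \<bar>e t\<bar>)"
      using mesh_in_unit[OF mesh, of n] mesh_in_unit[OF mesh, of "Suc n"] mesh_less[OF mesh, of n]
        step ci[of "x (Suc n)"]
      by (intro Henstock_Kurzweil_Integration.integral_combine) auto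
    moreover have "right_moment (?h n) (c n) (\<theta> n) * e (x n)
        + left_moment (?h (Suc n)) (c (Suc n)) (\<theta> (Suc n)) * e (x n) = 0"
      using orth[of n] step by (simp flip: distrib_right)
    ultimately show ?case
      using step local[of n] by simp
  qed
  from this[of N] show ?thesis
    using N x w' last by (simp add: right_moment_def e_def)
qed

lemma kink_without_overshoot:
  assumes mesh: "is_mesh N x" and N: "2 \<le> N"
  shows "\<forall>i\<in>{1..N - 1}. kink (x (N - 1)) 1 (x i) = 1"
    and "\<forall>t\<in>{0..1}. 0 \<le> kink (x (N - 1)) 1 t \<and> kink (x (N - 1)) 1 t \<le> 1"
proof -
  note c = last_interior_node[OF mesh N]
  show "\<forall>i\<in>{1..N - 1}. kink (x (N - 1)) 1 (x i) = 1"
    using mesh_mono[OF mesh, of _ "N - 1"] mesh_in_unit[OF mesh] c by (auto simp: kink_left)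
  show "\<forall>t\<in>{0..1}. 0 \<le> kink (x (N - 1)) 1 t \<and> kink (x (N - 1)) 1 t \<le> 1"
    using c by (auto simp: kink_def field_simps)
qed

lemma kink_best_L1_approximation:
  assumes mesh: "is_mesh N x" and N: "2 \<le> N"
    and mult: "\<And>i. i \<in> {1..N} \<Longrightarrow> 0 \<le> \<theta> i \<and> \<theta> i \<le> 1 \<and> \<bar>c i\<bar> \<le> 1"
    and last: "c N = 1" "\<theta> N = 0"
    and orth: "\<And>i. i \<in> {1..N - 1} \<Longrightarrow> right_moment (mesh_width x i) (c i) (\<theta> i)
        + left_moment (mesh_width x (Suc i)) (c (Suc i)) (\<theta> (Suc i)) = 0"
  shows "kink (x (N - 1)) 1 \<in> best_approximations 1 N x (\<lambda>_. 1)"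
  unfolding best_approximations_def mem_Collect_eq
proof (intro conjI ballI kink_admissible mesh N)
  let ?u = "kink (x (N - 1)) 1"
  let ?h = "mesh_width x N"
  fix w assume w: "w \<in> admissible N x"
  have x: "x (N - 1) = 1 - ?h" using mesh by (simp add: is_mesh_def mesh_width_def)
  have h: "0 < ?h" "?h < 1" using last_interior_node[OF mesh N] x by auto
  have "integral {0..1} (\<lambda>t. \<bar>1 - ?u t\<bar> powr 1) = ?h / 2"
    unfolding x using kink_integral_ge_one[of ?h 1 1] h by (simp add: kink_energy_def)
  moreover have "?h / 2 \<le> integral {0..1} (\<lambda>t. \<bar>1 - w t\<bar>)"
    using N by (intro L1_error_lower_bound[OF mesh w _ mult last orth]) auto
  ultimately show "Lq_norm 1 (\<lambda>t. 1 - ?u t) \<le> Lq_norm 1 (\<lambda>t. 1 - w t)"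
    using Lq_norm_error_le_iff[OF kink_admissible[OF mesh N] w, of 1] by simp
qed

section \<open>Multipliers for the two mesh conditions\<close>

lemma mesh_width_pos:
  assumes "is_mesh N x" "i \<in> {1..N}"
  shows "0 < mesh_width x i"
  using assms by (auto simp: is_mesh_def mesh_width_def)

text \<open>With alternating constants of equal mass on all intervals, both moments have modulus
  \<open>mesh_width x N / 2\<close> everywhere; the constants stay below \<open>1\<close> because the last interval is
  shortest.\<close>

lemma best_L1_approximation_last_shortest:
  assumes mesh: "is_mesh N x" and N: "2 \<le> N"
    and min: "\<And>i. i \<in> {1..N - 1} \<Longrightarrow> mesh_width x N \<le> mesh_width x i"
  shows "kink (x (N - 1)) 1 \<in> best_approximations 1 N x (\<lambda>_. 1)"
proof -
  let ?h = "mesh_width x"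
  let ?c = "\<lambda>i. (- 1) ^ (N - i) * ?h N / ?h i"
  let ?\<theta> = "\<lambda>_::nat. 0::real"
  note pos = mesh_width_pos[OF mesh]
  have last: "?c N = 1" "?\<theta> N = 0" using pos[of N] N by auto
  have mult: "0 \<le> ?\<theta> i \<and> ?\<theta> i \<le> 1 \<and> \<bar>?c i\<bar> \<le> 1" if "i \<in> {1..N}" for i
  proof -
    have "?h N \<le> ?h i" using min[of i] that by (cases "i = N") auto
    then show ?thesis using pos[OF that] pos[of N] N by (simp add: abs_mult power_abs)
  qed
  have orth: "right_moment (?h i) (?c i) (?\<theta> i) + left_moment (?h (Suc i)) (?c (Suc i)) (?\<theta> (Suc i)) = 0"
    if "i \<in> {1..N - 1}" for i
  proof -
    have "N - i = Suc (N - Suc i)" "i \<in> {1..N}" "Suc i \<in> {1..N}" using that by auto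
    then show ?thesis
      using pos[of i] pos[of "Suc i"] by (simp add: right_moment_def left_moment_def)
  qed
  from mult last orth show ?thesis
    by (rule kink_best_L1_approximation[OF mesh N, of ?\<theta> ?c])
qed

text \<open>The recursion for the \<open>\<vartheta>\<^sub>i\<close> is the orthogonality to the hat function at \<open>x\<^sub>i\<close> for multipliers of
  alternating sign that jump after the fraction \<open>\<vartheta>\<^sub>i\<close>.\<close>

lemma theta_step:
  assumes "i < N" "theta h N (Suc i) = Some t" "(2 * (1 - t)\<^sup>2 - 1) * h (Suc i) \<le> h i" "0 < h i"
  obtains s where "theta h N i = Some s" "0 \<le> s"
    "h i * (1 / 2 - s\<^sup>2) = h (Suc i) * ((1 - t)\<^sup>2 - 1 / 2)"
proof -
  define r where "r = 1 / 2 * (1 - (2 * (1 - t)\<^sup>2 - 1) * (h (Suc i) / h i))"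
  have r: "0 \<le> r" using assms(3,4) by (simp add: r_def field_simps)
  have "theta h N i = (if r < 0 then None else Some (sqrt r))"
    using assms(1,2) by (subst theta.simps) (simp add: r_def Let_def)
  hence "theta h N i = Some (sqrt r)" using r by simp
  moreover have "h i * (1 / 2 - (sqrt r)\<^sup>2) = h (Suc i) * ((1 - t)\<^sup>2 - 1 / 2)"
    using r assms(4) by (simp add: r_def field_simps)
  ultimately show ?thesis using r by (intro that[of "sqrt r"]) auto
qed

lemma theta_index_cases:
  assumes "M = theta_index h N"
  shows "M = 0 \<or> (M \<in> {1..N - 1} \<and> (\<exists>t. theta h N M = Some t \<and> 1 - 1 / sqrt 2 \<le> t))"
    and "M < i \<Longrightarrow> i \<le> N - 1 \<Longrightarrow> theta h N i = Some t \<Longrightarrow> t < 1 - 1 / sqrt 2"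
proof -
  let ?S = "{0} \<union> {i \<in> {1..N - 1}. \<exists>t. theta h N i = Some t \<and> t \<ge> 1 - 1 / sqrt 2}"
  have fin: "finite ?S" by simp
  have "M \<in> ?S" unfolding assms theta_index_def by (rule Max_in[OF fin]) simp
  then show "M = 0 \<or> (M \<in> {1..N - 1} \<and> (\<exists>t. theta h N M = Some t \<and> 1 - 1 / sqrt 2 \<le> t))" by blast
  assume i: "M < i" "i \<le> N - 1" "theta h N i = Some t"
  show "t < 1 - 1 / sqrt 2"
  proof (rule ccontr)
    assume "\<not> t < 1 - 1 / sqrt 2"
    hence "i \<in> ?S" using i by auto
    hence "i \<le> M" unfolding assms theta_index_def by (rule Max_ge[OF fin])
    with i show False by simp
  qed
qed

text \<open>The threshold \<open>1 - 1 / sqrt 2\<close> is the jump position at which the left moment vanishes. At the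
  index \<open>M\<close> the required right moment is at most the one belonging to the threshold, so a multiple of
  that multiplier matches it while having no left moment, and the zero multiplier can be used on all
  intervals further left.\<close>

lemma best_L1_approximation_theta:
  assumes mesh: "is_mesh N x" and N: "2 \<le> N" and h: "h = mesh_width x"
    and M: "M = theta_index h N"
    and cond: "\<And>i. max M 1 \<le> i \<Longrightarrow> i \<le> N - 1 \<Longrightarrow>
       \<exists>t. theta h N (i + 1) = Some t \<and> h i \<ge> (2 * (1 - t)\<^sup>2 - 1) * h (i + 1)"
  shows "kink (x (N - 1)) 1 \<in> best_approximations 1 N x (\<lambda>_. 1)"
proof -
  define z where "z = 1 - 1 / sqrt (2::real)"
  have z: "0 < z" "z < 1" "(1 - z)\<^sup>2 = 1 / 2"
    by (simp_all add: z_def power_divide)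
  have zz: "z\<^sup>2 < 1 / 2"
  proof -
    have "1 / 2 < 1 / sqrt (2::real)" using sqrt2_less_2 by (simp add: field_simps)
    hence "z < 1 / 2" by (simp add: z_def)
    moreover have "z\<^sup>2 = 2 * z - 1 / 2" using z(3) by (simp add: power2_eq_square algebra_simps)
    ultimately show ?thesis by simp
  qed
  have pos: "0 < h i" if "i \<in> {1..N}" for i using mesh_width_pos[OF mesh that] h by simp
  have MN: "M < N" using theta_index_cases(1)[OF M] N by auto
  define T where "T i = the (theta h N i)" for i
  have TN: "theta h N N = Some 0" by (subst theta.simps) simp
  \<comment> \<open>The mesh condition at \<open>i\<close> speaks of \<open>\<vartheta>\<close> at \<open>i + 1\<close>; its inequality makes the radicand at \<open>i\<close> nonnegative.
      For \<open>M = 0\<close> this yields the value at 1 as well.\<close>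
  have rec: "theta h N i = Some (T i) \<and> 0 \<le> T i \<and>
      h i * (1 / 2 - (T i)\<^sup>2) = h (Suc i) * ((1 - T (Suc i))\<^sup>2 - 1 / 2)"
    if i: "max M 1 \<le> i" "i \<le> N - 1" for i
  proof -
    obtain t where t: "theta h N (Suc i) = Some t" "(2 * (1 - t)\<^sup>2 - 1) * h (Suc i) \<le> h i"
      using cond[OF i] by auto
    moreover have "i < N" "0 < h i" using i N pos[of i] by auto
    ultimately obtain s where "theta h N i = Some s" "0 \<le> s"
      "h i * (1 / 2 - s\<^sup>2) = h (Suc i) * ((1 - t)\<^sup>2 - 1 / 2)"
      using theta_step by blast
    then show ?thesis using t by (simp add: T_def)
  qed
  have Tbd: "0 \<le> T i \<and> T i < z" if "M < i" "i \<le> N" for i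
  proof (cases "i = N")
    case True
    then show ?thesis using TN z by (simp add: T_def)
  next
    case False
    hence "theta h N i = Some (T i)" "0 \<le> T i" using rec[of i] that by auto
    then show ?thesis
      using theta_index_cases(2)[OF M, of i "T i"] that False by (simp add: z_def)
  qed
  define \<theta> where "\<theta> i = (if i \<le> M then z else T i)" for i
  \<comment> \<open>The height at \<open>M\<close> is the quotient of the required right moment by that of the threshold
      multiplier.\<close>
  define \<mu> where "\<mu> = (1 / 2 - (T M)\<^sup>2) / (1 / 2 - z\<^sup>2)"
  define c where "c i = (if i < M then 0 else if i = M then (- 1) ^ (N - i) * \<mu> else (- 1) ^ (N - i))" for i
  have \<mu>: "\<bar>\<mu>\<bar> \<le> 1" if "1 \<le> M"
  proof -
    have "z \<le> T M" using theta_index_cases(1)[OF M] that by (auto simp: T_def z_def)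
    hence "z\<^sup>2 \<le> (T M)\<^sup>2" using z by (intro power_mono) auto
    moreover have "(T M)\<^sup>2 \<le> 1 / 2"
    proof -
      \<comment> \<open>Maximality of \<open>M\<close> keeps the next value below the threshold, hence the left moment there
          is nonnegative and the radicand at \<open>M\<close> at most one half.\<close>
      have "T (Suc M) < z" using Tbd[of "Suc M"] MN by auto
      hence "(1 - z)\<^sup>2 \<le> (1 - T (Suc M))\<^sup>2" using z by (intro power_mono) auto
      hence "0 \<le> h (Suc M) * ((1 - T (Suc M))\<^sup>2 - 1 / 2)" using z pos[of "Suc M"] MN by simp
      also have "\<dots> = h M * (1 / 2 - (T M)\<^sup>2)" using rec[of M] that MN by auto
      finally show ?thesis using pos[of M] that MN by (simp add: zero_le_mult_iff)
    qed
    ultimately show ?thesis using zz by (simp add: \<mu>_def)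
  qed
  show ?thesis
  proof (rule kink_best_L1_approximation[OF mesh N])
    show "c N = 1" "\<theta> N = 0" using MN TN by (auto simp: c_def \<theta>_def T_def)
    show "0 \<le> \<theta> i \<and> \<theta> i \<le> 1 \<and> \<bar>c i\<bar> \<le> 1" if "i \<in> {1..N}" for i
      using that z \<mu> Tbd[of i] by (auto simp: \<theta>_def c_def abs_mult power_abs)
    show "right_moment (mesh_width x i) (c i) (\<theta> i)
        + left_moment (mesh_width x (Suc i)) (c (Suc i)) (\<theta> (Suc i)) = 0"
      if i: "i \<in> {1..N - 1}" for i
    proof (cases "i < M")
      case True
      hence "c i = 0" "\<theta> (Suc i) = z" by (auto simp: c_def \<theta>_def)
      then show ?thesis using z by (simp add: right_moment_def left_moment_def)
    next
      case False
      define \<sigma> :: real where "\<sigma> = (- 1) ^ (N - i)"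
      have "N - i = Suc (N - Suc i)" using i by auto
      hence "c (Suc i) = - \<sigma>" "\<theta> (Suc i) = T (Suc i)"
        using False by (auto simp: c_def \<sigma>_def \<theta>_def)
      moreover have "c i * (1 / 2 - (\<theta> i)\<^sup>2) = \<sigma> * (1 / 2 - (T i)\<^sup>2)"
        using False zz by (auto simp: c_def \<theta>_def \<sigma>_def \<mu>_def)
      hence "right_moment (h i) (c i) (\<theta> i) = \<sigma> * (h i * (1 / 2 - (T i)\<^sup>2))"
        by (simp add: right_moment_def mult.left_commute mult.assoc)
      ultimately show ?thesis
        using rec[of i] i False by (simp add: h[symmetric] left_moment_def)
    qed
  qed
qed

section \<open>Best approximations of the constant function\<close>

theorem theorem1p1:
  shows "(\<forall>(h::real) (q::real) (x::nat \<Rightarrow> real).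
            0 < h \<and> h < 1 \<and> 1 \<le> q \<and> is_mesh 2 x \<and> x 1 = 1 - h \<longrightarrow>
            (\<exists>\<alpha>. alpha_condition q h \<alpha>) \<and>
            (\<forall>\<alpha>. alpha_condition q h \<alpha> \<longrightarrow>
               (\<exists>u\<in>Uh 2 x. u 0 = 1 \<and> u 1 = 0 \<and> u (1 - h) = \<alpha> \<and>
                  best_approximations q 2 x (\<lambda>_. 1) = {u})))
       \<and> (\<forall>(N::nat) (x::nat \<Rightarrow> real) (h::nat \<Rightarrow> real) (M::nat).
            2 \<le> N \<and> is_mesh N x \<and> h = mesh_width x \<and> M = theta_index h N \<and>
            (\<forall>i. max M 1 \<le> i \<and> i \<le> N - 1 \<longrightarrow>
               (\<exists>t. theta h N (i + 1) = Some t \<and>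
                    h i \<ge> (2 * (1 - t)\<^sup>2 - 1) * h (i + 1))) \<longrightarrow>
            (\<exists>u\<in>best_approximations 1 N x (\<lambda>_. 1).
               (\<forall>i\<in>{1..N - 1}. u (x i) = 1) \<and> (\<forall>t\<in>{0..1}. 0 \<le> u t \<and> u t \<le> 1)))
       \<and> (\<forall>(N::nat) (x::nat \<Rightarrow> real) (h::nat \<Rightarrow> real).
            2 \<le> N \<and> is_mesh N x \<and> h = mesh_width x \<and> h N \<le> Min (h ` {1..N - 1}) \<longrightarrow>
            (\<exists>u\<in>best_approximations 1 N x (\<lambda>_. 1). \<forall>i\<in>{1..N - 1}. u (x i) = 1))"
proof (intro conjI allI impI; (elim conjE)?)
  fix h q :: real and x :: "nat \<Rightarrow> real"
  assume "0 < h" "h < 1" "1 \<le> q"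
  then show "\<exists>\<alpha>. alpha_condition q h \<alpha>" by (rule ex_alpha_condition)
next
  fix h q \<alpha> :: real and x :: "nat \<Rightarrow> real"
  assume h: "0 < h" "h < 1" and q: "1 \<le> q" and x: "is_mesh 2 x" "x 1 = 1 - h"
    and \<alpha>: "alpha_condition q h \<alpha>"
  have "kink (1 - h) \<alpha> \<in> admissible 2 x"
    using kink_admissible[OF x(1), of \<alpha>] x(2) by simp
  moreover have "kink (1 - h) \<alpha> (1 - h) = \<alpha>"
    using h by (simp add: kink_right)
  ultimately show "\<exists>u\<in>Uh 2 x. u 0 = 1 \<and> u 1 = 0 \<and> u (1 - h) = \<alpha> \<and>
      best_approximations q 2 x (\<lambda>_. 1) = {u}"
    using two_interval_best_approximations[OF h q x \<alpha>] by (auto simp: admissible_def)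
next
  fix N M :: nat and x h :: "nat \<Rightarrow> real"
  assume "2 \<le> N" "is_mesh N x" "h = mesh_width x" "M = theta_index h N"
    "\<forall>i. max M 1 \<le> i \<and> i \<le> N - 1 \<longrightarrow>
       (\<exists>t. theta h N (i + 1) = Some t \<and> h i \<ge> (2 * (1 - t)\<^sup>2 - 1) * h (i + 1))"
  then show "\<exists>u\<in>best_approximations 1 N x (\<lambda>_. 1).
      (\<forall>i\<in>{1..N - 1}. u (x i) = 1) \<and> (\<forall>t\<in>{0..1}. 0 \<le> u t \<and> u t \<le> 1)"
    by (intro bexI[OF _ best_L1_approximation_theta] conjI kink_without_overshoot) auto
next
  fix N :: nat and x h :: "nat \<Rightarrow> real"
  assume "2 \<le> N" "is_mesh N x" and h: "h = mesh_width x" "h N \<le> Min (h ` {1..N - 1})"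
  moreover from h have "mesh_width x N \<le> mesh_width x i" if "i \<in> {1..N - 1}" for i
    using that by (auto intro: order_trans[OF _ Min_le])
  ultimately show "\<exists>u\<in>best_approximations 1 N x (\<lambda>_. 1). \<forall>i\<in>{1..N - 1}. u (x i) = 1"
    by (intro bexI[OF _ best_L1_approximation_last_shortest] kink_without_overshoot) auto
qed

end
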